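(* Suppose the dictionary $\boldsymbol{\psi}$ lies in the non-redundant span of $r$ Koopman eigenfunctions $\phi_1,\dots,\phi_r$ with distinct eigenvalues $\lambda_1,\dots,\lambda_r$, and the initial condition $\boldsymbol{\upsilon}_1$ is spectrally informative. If $\boldsymbol{\psi}$ is also Koopman invariant, then: (1) when $n=r$, mean-subtracted DMD is equivalent to temporal DFT if and only if $1\notin\{\lambda_1,\dots,\lambda_r\}$; (2) when $n<r$, mean-subtracted DMD is equivalent to temporal DFT.
   Context: Setting: $\Gamma:\mathbb{R}^p\to\mathbb{R}^p$ is a map. $\mathcal{H}$ is a vector space of complex-valued functions on $\mathbb{R}^p$ closed under composition with $\Gamma$; the Koopman operator is $U:\mathcal{H}\to\mathcal{H}$, $U\psi=\psi\circ\Gamma$, acting componentwise on vector-valued observables; a Koopman eigenfunction with eigenvalue $\lambda$ is $\phi\in\mathcal{H}$ with $U\phi=\lambda\phi$. A dictionary is a column vector $\boldsymbol{\psi}=[\psi_i]_{i=1}^m$ of observables. Non-redundant span: $\boldsymbol{\psi}$ lies in the non-redundant span of $r$ distinct Koopman eigenfunctions $\phi_1,\dots,\phi_r$ (having pairwise distinct eigenvalues) if, with $\boldsymbol{\phi}=[\phi_i]_{i=1}^r$, there is $\tilde{\mathbf{C}}\in\mathbb{C}^{m\times r}$ with $\boldsymbol{\psi}=\tilde{\mathbf{C}}\boldsymbol{\phi}$ and every column of $\tilde{\mathbf{C}}$ is non-zero. The state $\boldsymbol{\upsilon}_1$ is spectrally informative if $\phi_i(\boldsymbol{\upsilon}_1)\ne0$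 for all $i$. $\boldsymbol{\psi}$ is Koopman invariant if there is a matrix $\mathbf{A}$ with $U\circ\boldsymbol{\psi}=\mathbf{A}\boldsymbol{\psi}$. Data and mean-subtracted DMD: $n\ge1$; $\mathbf{z}_j=\boldsymbol{\psi}(\Gamma^{j-1}(\boldsymbol{\upsilon}_1))$, $j=1,\dots,n+1$; $\boldsymbol{\mu}=\frac{1}{n+1}\sum_{j=1}^{n+1}\mathbf{z}_j$; $\mathbf{X}_{\rm ms}=[\mathbf{z}_j-\boldsymbol{\mu}]_{j=1}^n$; $\mathbf{c}^*=\mathbf{X}_{\rm ms}^{\dagger}(\mathbf{z}_{n+1}-\boldsymbol{\mu})$ with $\dagger$ the Moore-Penrose pseudo-inverse. The mean-subtracted DMD eigenvalues $\{\tilde\lambda_i\}_{i=1}^n$ are the eigenvalues of the $n\times n$ companion matrix with $1$'s on the first sub-diagonal, last column $\mathbf{c}^*$, and zeros elsewhere. Mean-subtracted DMD is equivalent to (temporal) DFT when $\{\tilde\lambda_i\}_{i=1}^n=\{z\in\mathbb{C}: z\ne1,\ z^{n+1}=1\}$. *)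

theory Defs
  imports
    "HOL-Analysis.Analysis"
    "HOL-Library.Function_Algebras"
    "Jordan_Normal_Form.Spectral_Radius"
begin

text \<open>
  The state space is \<open>real ^ 'p\<close>, while vectors and matrices whose sizes
  \<open>m\<close>, \<open>n\<close>, \<open>r\<close> are compared with each other are those of
  Jordan_Normal_Form; its indices, and hence all indices below, start at 0.
\<close>

unbundle no vec_syntax
hide_const (open) Finite_Cartesian_Product.vec
hide_type (open) Finite_Cartesian_Product.vec

interpretation complex_fun: vector_space "\<lambda>(c::complex) (f::'a \<Rightarrow> complex) x. c * f x"
  by unfold_locales (auto simp: fun_eq_iff algebra_simps)

type_synonym 'p observable = "real ^ 'p \<Rightarrow> complex"

definition koopman :: "('s \<Rightarrow> 's) \<Rightarrow> ('s \<Rightarrow> complex) \<Rightarrow> 's \<Rightarrow> complex" where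
  "koopman \<Gamma> f = f \<circ> \<Gamma>"

definition observable_space :: "(real ^ 'p \<Rightarrow> real ^ 'p) \<Rightarrow> 'p observable set \<Rightarrow> bool" where
  "observable_space \<Gamma> H \<longleftrightarrow> complex_fun.subspace H \<and> (\<forall>f\<in>H. koopman \<Gamma> f \<in> H)"

definition koopman_eigenfunction ::
  "(real ^ 'p \<Rightarrow> real ^ 'p) \<Rightarrow> 'p observable set \<Rightarrow> complex \<Rightarrow> 'p observable \<Rightarrow> bool" where
  "koopman_eigenfunction \<Gamma> H l f \<longleftrightarrow> f \<in> H \<and> koopman \<Gamma> f = (\<lambda>x. l * f x)"

definition dictionary :: "'p observable set \<Rightarrow> nat \<Rightarrow> 'p observable vec \<Rightarrow> bool" where
  "dictionary H m \<psi> \<longleftrightarrow> \<psi> \<in> carrier_vec m \<and> (\<forall>i<m. \<psi> $ i \<in> H)"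

definition eval_vec :: "'p observable vec \<Rightarrow> real ^ 'p \<Rightarrow> complex vec" where
  "eval_vec \<psi> x = map_vec (\<lambda>f. f x) \<psi>"

definition nonredundant_span ::
  "(real ^ 'p \<Rightarrow> real ^ 'p) \<Rightarrow> 'p observable set \<Rightarrow> nat \<Rightarrow> nat \<Rightarrow>
   (nat \<Rightarrow> complex) \<Rightarrow> 'p observable vec \<Rightarrow> 'p observable vec \<Rightarrow> bool" where
  "nonredundant_span \<Gamma> H m r l \<phi> \<psi> \<longleftrightarrow>
     \<phi> \<in> carrier_vec r \<and>
     (\<forall>i<r. koopman_eigenfunction \<Gamma> H (l i) (\<phi> $ i)) \<and>
     inj_on (\<lambda>i. \<phi> $ i) {..<r} \<and> inj_on l {..<r} \<and>
     (\<exists>C \<in> carrier_mat m r.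
        (\<forall>x. eval_vec \<psi> x = C *\<^sub>v eval_vec \<phi> x) \<and> (\<forall>j<r. col C j \<noteq> 0\<^sub>v m))"

definition spectrally_informative :: "'p observable vec \<Rightarrow> real ^ 'p \<Rightarrow> bool" where
  "spectrally_informative \<phi> v \<longleftrightarrow> (\<forall>i<dim_vec \<phi>. (\<phi> $ i) v \<noteq> 0)"

definition koopman_invariant ::
  "(real ^ 'p \<Rightarrow> real ^ 'p) \<Rightarrow> nat \<Rightarrow> 'p observable vec \<Rightarrow> bool" where
  "koopman_invariant \<Gamma> m \<psi> \<longleftrightarrow>
     (\<exists>A \<in> carrier_mat m m. \<forall>x. eval_vec (map_vec (koopman \<Gamma>) \<psi>) x = A *\<^sub>v eval_vec \<psi> x)"

text \<open>The four Penrose conditions, which determine a unique matrix.\<close>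

definition is_pseudo_inverse :: "complex mat \<Rightarrow> complex mat \<Rightarrow> bool" where
  "is_pseudo_inverse A P \<longleftrightarrow>
     P \<in> carrier_mat (dim_col A) (dim_row A) \<and>
     A * P * A = A \<and> P * A * P = P \<and>
     mat_adjoint (A * P) = A * P \<and> mat_adjoint (P * A) = P * A"

definition pseudo_inverse :: "complex mat \<Rightarrow> complex mat" where
  "pseudo_inverse A = (THE P. is_pseudo_inverse A P)"

text \<open>With indices starting at 0, \<open>snapshot \<Gamma> \<psi> v j\<close> is the datum \<open>z\<^sub>j\<^sub>+\<^sub>1\<close>.\<close>

definition snapshot ::
  "(real ^ 'p \<Rightarrow> real ^ 'p) \<Rightarrow> 'p observable vec \<Rightarrow> real ^ 'p \<Rightarrow> nat \<Rightarrow> complex vec" where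
  "snapshot \<Gamma> \<psi> v j = eval_vec \<psi> ((\<Gamma> ^^ j) v)"

definition snapshot_mean ::
  "(real ^ 'p \<Rightarrow> real ^ 'p) \<Rightarrow> 'p observable vec \<Rightarrow> real ^ 'p \<Rightarrow> nat \<Rightarrow> complex vec" where
  "snapshot_mean \<Gamma> \<psi> v n =
     vec (dim_vec \<psi>) (\<lambda>i. (\<Sum>j<n+1. snapshot \<Gamma> \<psi> v j $ i) / of_nat (n + 1))"

definition X_ms ::
  "(real ^ 'p \<Rightarrow> real ^ 'p) \<Rightarrow> 'p observable vec \<Rightarrow> real ^ 'p \<Rightarrow> nat \<Rightarrow> complex mat" where
  "X_ms \<Gamma> \<psi> v n =
     mat_of_cols (dim_vec \<psi>) (map (\<lambda>j. snapshot \<Gamma> \<psi> v j - snapshot_mean \<Gamma> \<psi> v n) [0..<n])"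

definition c_ms ::
  "(real ^ 'p \<Rightarrow> real ^ 'p) \<Rightarrow> 'p observable vec \<Rightarrow> real ^ 'p \<Rightarrow> nat \<Rightarrow> complex vec" where
  "c_ms \<Gamma> \<psi> v n =
     pseudo_inverse (X_ms \<Gamma> \<psi> v n) *\<^sub>v (snapshot \<Gamma> \<psi> v n - snapshot_mean \<Gamma> \<psi> v n)"

definition companion :: "complex vec \<Rightarrow> complex mat" where
  "companion c = mat (dim_vec c) (dim_vec c)
     (\<lambda>(i, j). if j + 1 = dim_vec c then c $ i else if i = j + 1 then 1 else 0)"

definition ms_dmd_eigenvalues ::
  "(real ^ 'p \<Rightarrow> real ^ 'p) \<Rightarrow> 'p observable vec \<Rightarrow> real ^ 'p \<Rightarrow> nat \<Rightarrow> complex set" where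
  "ms_dmd_eigenvalues \<Gamma> \<psi> v n = spectrum (companion (c_ms \<Gamma> \<psi> v n))"

text \<open>
  Since the right-hand side has \<open>n\<close> elements and the companion matrix has size \<open>n\<close>,
  equality of sets already forces all DMD eigenvalues to be simple.
\<close>

definition ms_dmd_equiv_dft ::
  "(real ^ 'p \<Rightarrow> real ^ 'p) \<Rightarrow> 'p observable vec \<Rightarrow> real ^ 'p \<Rightarrow> nat \<Rightarrow> bool" where
  "ms_dmd_equiv_dft \<Gamma> \<psi> v n \<longleftrightarrow>
     ms_dmd_eigenvalues \<Gamma> \<psi> v n = {z. z \<noteq> 1 \<and> z ^ (n + 1) = 1}"

end

theory Submission
  imports Defs
begin

text \<open>
  The centered snapshots sum to zero, so \<open>(-1, \<dots>, -1)\<close> solves the DMD least squares problem exactly,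
  and its companion matrix has precisely the nontrivial \<open>(n+1)\<close>-st roots of unity as eigenvalues.
  DMD is thus the DFT iff this is the minimum-norm solution, that is, iff it is orthogonal to the
  kernel of the centered data matrix. Reading kernel elements as polynomials \<open>p\<close> of degree at most \<open>n\<close>
  turns this into: every \<open>p\<close> with \<open>p(1) = 0\<close> and \<open>p(l\<^sub>k) = 0\<close> for all \<open>k\<close> has vanishing \<open>n\<close>-th
  coefficient (Koopman invariance is what makes the condition on the snapshots equivalent to
  \<open>p(l\<^sub>k) = 0\<close>). If \<open>1, l\<^sub>1, \<dots>, l\<^sub>r\<close> contain more than \<open>n\<close> distinct points then \<open>p = 0\<close>; if
  \<open>n = r\<close> and \<open>1\<close> is among the \<open>l\<^sub>k\<close>, the product of all \<open>x - l\<^sub>k\<close> is a counterexample.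
\<close>

section \<open>Generalized inverses over an arbitrary field\<close>

text \<open>Column by column: the residual \<open>u\<close> of the new column \<open>a\<^sub>n\<close> is split off by a row \<open>q\<close> that
  annihilates the old columns and is dual to \<open>a\<^sub>n\<close> (unless \<open>u = 0\<close>).\<close>

lemma sum_generalized_inverse_exists:
  fixes a :: "nat \<Rightarrow> nat \<Rightarrow> 'a::field"
  shows "\<exists>G. \<forall>t<n. \<forall>i<m. (\<Sum>j<n. a j i * (\<Sum>k<m. G j k * a t k)) = a t i"
proof (induction n)
  case 0
  then show ?case by simp
next
  case (Suc n)
  then obtain G where G: "\<And>t i. t < n \<Longrightarrow> i < m \<Longrightarrow> (\<Sum>j<n. a j i * (\<Sum>k<m. G j k * a t k)) = a t i"
    by blast
  define u where "u i = a n i - (\<Sum>j<n. a j i * (\<Sum>k<m. G j k * a n k))" for i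
  have "\<exists>q. (\<forall>t<n. (\<Sum>k<m. q k * a t k) = 0) \<and> (\<forall>i<m. u i * (\<Sum>k<m. q k * a n k) = u i)"
  proof (cases "\<forall>i<m. u i = 0")
    case True
    then show ?thesis by (intro exI[of _ "\<lambda>_. 0"]) auto
  next
    case False
    then obtain i0 where i0: "i0 < m" "u i0 \<noteq> 0" by auto
    \<comment> \<open>This is row \<open>i0\<close> of \<open>I - A G\<close>, with \<open>A\<close>
      the matrix of the old columns \<open>a 0, ..., a (n-1)\<close>, scaled by
      \<open>1 / u i0\<close>. It kills the old columns because \<open>A G A = A\<close>, and it
      sends \<open>a n\<close> to \<open>u i0 / u i0\<close>.\<close>
    define q where "q k = ((if k = i0 then 1 else 0) - (\<Sum>j<n. a j i0 * G j k)) / u i0" for k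
    have q: "(\<Sum>k<m. q k * a t k) = (a t i0 - (\<Sum>j<n. a j i0 * (\<Sum>k<m. G j k * a t k))) / u i0" for t
    proof -
      have "(\<Sum>k<m. q k * a t k) =
          (\<Sum>k<m. (if k = i0 then a t k else 0) - (\<Sum>j<n. a j i0 * G j k * a t k)) / u i0"
        unfolding q_def sum_divide_distrib
        by (intro sum.cong) (auto simp: left_diff_distrib sum_distrib_right)
      also have "(\<Sum>k<m. (if k = i0 then a t k else 0) - (\<Sum>j<n. a j i0 * G j k * a t k)) =
          a t i0 - (\<Sum>j<n. a j i0 * (\<Sum>k<m. G j k * a t k))"
        using i0 unfolding sum_subtractf
        by (subst sum.swap) (simp add: sum_distrib_left mult.assoc)
      finally show ?thesis .
    qed
    have "(\<Sum>k<m. q k * a n k) = 1"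
      using i0 unfolding q u_def[symmetric] by simp
    moreover have "(\<Sum>k<m. q k * a t k) = 0" if "t < n" for t
      using i0 G[OF that i0(1)] unfolding q by simp
    ultimately show ?thesis by (intro exI[of _ q]) auto
  qed
  then obtain q where q: "\<And>t. t < n \<Longrightarrow> (\<Sum>k<m. q k * a t k) = 0"
    "\<And>i. i < m \<Longrightarrow> u i * (\<Sum>k<m. q k * a n k) = u i" by blast
  \<comment> \<open>The new row is \<open>q\<close>; the old rows are corrected so that the extended
    matrix times \<open>F\<close> equals \<open>A G\<close> plus the outer product of
    \<open>u\<close> and \<open>q\<close>. The extra term vanishes on the old columns and supplies
    the residual on \<open>a n\<close>.\<close>
  define F where "F j k = (if j < n then G j k - (\<Sum>s<m. G j s * a n s) * q k else q k)" for j k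
  have F: "(\<Sum>j<Suc n. a j i * (\<Sum>k<m. F j k * a t k)) =
      (\<Sum>j<n. a j i * (\<Sum>k<m. G j k * a t k)) + u i * (\<Sum>k<m. q k * a t k)" for t i
  proof -
    have "(\<Sum>k<m. F j k * a t k) =
        (\<Sum>k<m. G j k * a t k) - (\<Sum>s<m. G j s * a n s) * (\<Sum>k<m. q k * a t k)" if "j < n" for j
      using that unfolding F_def
      by (simp add: left_diff_distrib sum_subtractf sum_distrib_left mult.assoc)
    then have "(\<Sum>j<n. a j i * (\<Sum>k<m. F j k * a t k)) =
        (\<Sum>j<n. a j i * (\<Sum>k<m. G j k * a t k)) -
        (\<Sum>j<n. a j i * (\<Sum>s<m. G j s * a n s)) * (\<Sum>k<m. q k * a t k)"
      unfolding sum_distrib_right[of "\<lambda>j. a j i * (\<Sum>s<m. G j s * a n s)"] sum_subtractf[symmetric]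
      by (intro sum.cong) (auto simp: right_diff_distrib mult.assoc)
    then show ?thesis by (simp add: F_def u_def algebra_simps)
  qed
  have "(\<Sum>j<Suc n. a j i * (\<Sum>k<m. F j k * a t k)) = a t i" if "t < Suc n" "i < m" for t i
  proof (cases "t = n")
    case True
    show ?thesis unfolding F True q(2)[OF that(2)] by (simp add: u_def)
  next
    case False
    then show ?thesis unfolding F using that G q(1) by simp
  qed
  then show ?case by blast
qed

lemma mult_mat_index:
  assumes "A \<in> carrier_mat p n" "B \<in> carrier_mat n m" "i < p" "j < m"
  shows "(A * B) $$ (i, j) = (\<Sum>k<n. A $$ (i, k) * B $$ (k, j))"
  using assms by (auto simp: scalar_prod_def atLeast0LessThan intro!: sum.cong)

lemma mult_mat_vec_index:
  assumes "A \<in> carrier_mat m n" "v \<in> carrier_vec n" "i < m"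
  shows "(A *\<^sub>v v) $ i = (\<Sum>k<n. A $$ (i, k) * v $ k)"
  using assms by (auto simp: scalar_prod_def atLeast0LessThan intro!: sum.cong)

text \<open>Index functions let the preceding induction append a column without changing matrix
  dimensions; here its result is read for the entries of \<open>A\<close>.\<close>

lemma generalized_inverse_exists:
  fixes A :: "'a::field mat"
  assumes A: "A \<in> carrier_mat m n"
  shows "\<exists>G \<in> carrier_mat n m. A * G * A = A"
proof -
  obtain G where G: "\<And>t i. t < n \<Longrightarrow> i < m \<Longrightarrow>
      (\<Sum>j<n. A $$ (i, j) * (\<Sum>k<m. G j k * A $$ (k, t))) = A $$ (i, t)"
    using sum_generalized_inverse_exists[of n m "\<lambda>j i. A $$ (i, j)"] by auto
  define P where "P = mat n m (\<lambda>(j, k). G j k)"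
  have P: "P \<in> carrier_mat n m" by (simp add: P_def)
  have "A * (P * A) = A"
  proof (rule eq_matI)
    fix i t assume "i < dim_row A" "t < dim_col A"
    then have it: "i < m" "t < n" using A by auto
    have "(A * (P * A)) $$ (i, t) = (\<Sum>j<n. A $$ (i, j) * (P * A) $$ (j, t))"
      using A P it by (intro mult_mat_index[of _ m _ _ n]) auto
    also have "\<dots> = (\<Sum>j<n. A $$ (i, j) * (\<Sum>k<m. P $$ (j, k) * A $$ (k, t)))"
      using mult_mat_index[OF P A _ it(2)] by (intro sum.cong) auto
    also have "\<dots> = (\<Sum>j<n. A $$ (i, j) * (\<Sum>k<m. G j k * A $$ (k, t)))"
      by (intro sum.cong arg_cong2[of _ _ _ _ "(*)"]) (auto simp: P_def)
    finally show "(A * (P * A)) $$ (i, t) = A $$ (i, t)" using G it by simp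
  qed (use A P in auto)
  then show ?thesis using A P by (intro bexI[of _ P]) (auto simp: assoc_mult_mat)
qed

section \<open>Adjoints of matrices\<close>

lemma mat_adjoint_carrier [simp]:
  "A \<in> carrier_mat m n \<Longrightarrow> mat_adjoint A \<in> carrier_mat n m"
  by (auto simp: mat_adjoint_def)

lemma dim_mat_adjoint [simp]:
  "dim_row (mat_adjoint A) = dim_col A" "dim_col (mat_adjoint A) = dim_row A"
  by (auto simp: mat_adjoint_def)

lemma mat_adjoint_index:
  assumes "A \<in> carrier_mat m n" "i < n" "j < m"
  shows "mat_adjoint A $$ (i, j) = conjugate (A $$ (j, i))"
  using assms by (auto simp: mat_adjoint_def mat_of_rows_def)

lemma mat_adjoint_adjoint:
  "mat_adjoint (mat_adjoint A) = A"
proof -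
  have A: "A \<in> carrier_mat (dim_row A) (dim_col A)" by simp
  show ?thesis
    by (intro eq_matI) (auto simp: mat_adjoint_index[OF A] mat_adjoint_index[OF mat_adjoint_carrier[OF A]])
qed

lemma mat_adjoint_mult:
  fixes A B :: "complex mat"
  assumes A: "A \<in> carrier_mat p n" and B: "B \<in> carrier_mat n m"
  shows "mat_adjoint (A * B) = mat_adjoint B * mat_adjoint A"
proof (rule eq_matI)
  note AB = mult_carrier_mat[OF A B]
  note A' = mat_adjoint_carrier[OF A] and B' = mat_adjoint_carrier[OF B]
  fix i j assume "i < dim_row (mat_adjoint B * mat_adjoint A)" "j < dim_col (mat_adjoint B * mat_adjoint A)"
  then have ij: "i < m" "j < p" using A' B' by auto
  show "mat_adjoint (A * B) $$ (i, j) = (mat_adjoint B * mat_adjoint A) $$ (i, j)"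
    unfolding mat_adjoint_index[OF AB ij] mult_mat_index[OF B' A' ij] mult_mat_index[OF A B ij(2,1)]
    by (auto simp: mat_adjoint_index[OF A] mat_adjoint_index[OF B] ij intro!: sum.cong)
qed (use A B in auto)

text \<open>The \<open>j\<close>-th diagonal entry of the Gram matrix \<open>A\<^sup>* A\<close> is
  the squared norm of column \<open>j\<close> of \<open>A\<close>.\<close>

lemma mat_adjoint_mult_self_eq_0:
  fixes A :: "complex mat"
  assumes A: "A \<in> carrier_mat m n" and 0: "mat_adjoint A * A = 0\<^sub>m n n"
  shows "A = 0\<^sub>m m n"
proof (rule eq_matI)
  fix i j assume "i < dim_row (0\<^sub>m m n)" "j < dim_col (0\<^sub>m m n)"
  then have ij: "i < m" "j < n" by auto
  have "(\<Sum>k<m. complex_of_real ((cmod (A $$ (k, j)))\<^sup>2)) = (mat_adjoint A * A) $$ (j, j)"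
    unfolding mult_mat_index[OF mat_adjoint_carrier[OF A] A ij(2) ij(2)]
    by (intro sum.cong) (auto simp: mat_adjoint_index[OF A ij(2)] complex_norm_square mult.commute
        simp del: of_real_power)
  also have "\<dots> = 0" using 0 ij by simp
  finally have "(\<Sum>k<m. (cmod (A $$ (k, j)))\<^sup>2) = 0"
    by (metis of_real_sum of_real_eq_0_iff)
  then have "\<forall>k<m. (cmod (A $$ (k, j)))\<^sup>2 = 0"
    by (subst (asm) sum_nonneg_eq_0_iff) auto
  then show "A $$ (i, j) = 0\<^sub>m m n $$ (i, j)" using ij by simp
qed (use A in auto)

section \<open>Existence and uniqueness of the Moore-Penrose pseudo-inverse\<close>

text \<open>For any generalized inverse \<open>G\<close> of \<open>A\<^sup>* A\<close> one has \<open>A G A\<^sup>* A = A\<close>, and \<open>A G A\<^sup>*\<close> does not depend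
  on the choice of \<open>G\<close>; in particular it is Hermitian.\<close>

lemma hermitian_generalized_inverse_exists:
  fixes A :: "complex mat"
  assumes A: "A \<in> carrier_mat m n"
  shows "\<exists>P \<in> carrier_mat n m. A * P * A = A \<and> mat_adjoint (A * P) = A * P"
proof -
  let ?S = "mat_adjoint A"
  let ?H = "?S * A"
  have S: "?S \<in> carrier_mat n m" using A by simp
  then have H: "?H \<in> carrier_mat n n" using A by (rule mult_carrier_mat)
  obtain G where G: "G \<in> carrier_mat n n" and HGH: "?H * G * ?H = ?H"
    using generalized_inverse_exists[OF H] by blast
  have GH: "G * ?H \<in> carrier_mat n n" using G H by (rule mult_carrier_mat)
  \<comment> \<open>\<open>W\<close> measures the failure of \<open>A G ?H = A\<close>. It satisfies
    \<open>?S W = 0\<close> and has the form \<open>A E\<close>, so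
    \<open>W\<^sup>* W = E\<^sup>* ?S W = 0\<close>, which forces \<open>W = 0\<close>.\<close>
  define W where "W = A * (G * ?H) - A"
  have W: "W \<in> carrier_mat m n"
    unfolding W_def by (rule minus_carrier_mat[OF A])
  have SW: "?S * W = 0\<^sub>m n n"
  proof -
    have "?S * W = ?S * (A * (G * ?H)) - ?S * A"
      unfolding W_def using A G H S by (intro mult_minus_distrib_mat) auto
    also have "?S * (A * (G * ?H)) = ?H * G * ?H"
      unfolding assoc_mult_mat[OF S A GH, symmetric] assoc_mult_mat[OF H G H] ..
    finally show ?thesis using HGH H by (simp add: minus_r_inv_mat)
  qed
  define E where "E = G * ?H - 1\<^sub>m n"
  have E: "E \<in> carrier_mat n n" unfolding E_def by (rule minus_carrier_mat[OF one_carrier_mat])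
  have WE: "W = A * E"
    unfolding W_def E_def using A GH by (subst mult_minus_distrib_mat[of _ m n _ n]) auto
  have "mat_adjoint W * W = mat_adjoint E * ?S * W"
    using mat_adjoint_mult[OF A E] by (simp only: WE)
  also have "\<dots> = mat_adjoint E * (?S * W)"
    using mat_adjoint_carrier[OF E] S W by (rule assoc_mult_mat)
  also have "\<dots> = 0\<^sub>m n n"
    unfolding SW by (rule right_mult_zero_mat[OF mat_adjoint_carrier[OF E]])
  finally have W0: "W = 0\<^sub>m m n" by (rule mat_adjoint_mult_self_eq_0[OF W])
  have AGH: "A * (G * ?H) = A"
  proof (rule eq_matI)
    fix i j assume ij: "i < dim_row A" "j < dim_col A"
    have "(A * (G * ?H) - A) $$ (i, j) = 0" using W0 ij A by (simp add: W_def)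
    moreover have "(A * (G * ?H) - A) $$ (i, j) = (A * (G * ?H)) $$ (i, j) - A $$ (i, j)"
      using ij by (intro index_minus_mat)
    ultimately show "(A * (G * ?H)) $$ (i, j) = A $$ (i, j)" by simp
  qed (use A G H in auto)
  have G': "mat_adjoint G \<in> carrier_mat n n" using G by simp
  have Hadj: "mat_adjoint ?H = ?H"
    using mat_adjoint_mult[OF S A] by (simp add: mat_adjoint_adjoint)
  have "mat_adjoint (A * (G * ?H)) = ?H * mat_adjoint G * ?S"
    by (simp only: mat_adjoint_mult[OF A GH] mat_adjoint_mult[OF G H] Hadj)
  then have S_eq: "?H * mat_adjoint G * ?S = ?S" unfolding AGH by simp
  \<comment> \<open>Replacing \<open>?S\<close> by \<open>?H G\<^sup>* ?S\<close> on the left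
    exposes the factor \<open>A G ?H\<close>, which collapses to \<open>A\<close>.\<close>
  have sym: "A * G * ?S = A * mat_adjoint G * ?S"
  proof -
    note GS = mult_carrier_mat[OF G' S]
    note HGS = mult_carrier_mat[OF H GS] and AGH' = mult_carrier_mat[OF A GH]
    have "A * G * ?S = A * G * (?H * mat_adjoint G * ?S)" by (simp only: S_eq)
    also have "\<dots> = A * (G * ?H) * mat_adjoint G * ?S"
      by (simp only: assoc_mult_mat[OF H G' S] assoc_mult_mat[OF A G HGS] assoc_mult_mat[OF AGH' G' S]
          assoc_mult_mat[OF A GH GS] assoc_mult_mat[OF G H GS])
    finally show ?thesis by (simp only: AGH)
  qed
  note GS = mult_carrier_mat[OF G S]
  note AGS = assoc_mult_mat[OF A G S]
  have "mat_adjoint (A * (G * ?S)) = A * mat_adjoint G * ?S"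
    unfolding mat_adjoint_mult[OF A GS] mat_adjoint_mult[OF G S] mat_adjoint_adjoint ..
  moreover have "A * (G * ?S) * A = A"
    unfolding assoc_mult_mat[OF A GS A] assoc_mult_mat[OF G S A] by (rule AGH)
  ultimately show ?thesis using GS AGS sym by (intro bexI[of _ "G * ?S"]) auto
qed

text \<open>If \<open>A P\<close> and \<open>Q A\<close> are Hermitian for generalized inverses \<open>P\<close>, \<open>Q\<close> of \<open>A\<close>, then \<open>Q A P\<close> is the
  pseudo-inverse; \<open>Q\<close> comes from the adjoint of \<open>A\<close>.\<close>

lemma is_pseudo_inverse_exists:
  fixes A :: "complex mat"
  assumes A: "A \<in> carrier_mat m n"
  shows "\<exists>P. is_pseudo_inverse A P"
proof -
  have A': "mat_adjoint A \<in> carrier_mat n m" using A by simp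
  obtain P where P: "P \<in> carrier_mat n m" "A * P * A = A" "mat_adjoint (A * P) = A * P"
    using hermitian_generalized_inverse_exists[OF A] by blast
  obtain R where R: "R \<in> carrier_mat m n" "mat_adjoint A * R * mat_adjoint A = mat_adjoint A"
    "mat_adjoint (mat_adjoint A * R) = mat_adjoint A * R"
    using hermitian_generalized_inverse_exists[OF A'] by blast
  define Q where "Q = mat_adjoint R"
  have Q: "Q \<in> carrier_mat n m" using R by (simp add: Q_def)
  have QA: "mat_adjoint A * R = Q * A"
    using R(3) mat_adjoint_mult[OF A' R(1)] by (simp add: Q_def mat_adjoint_adjoint)
  have AQA: "A * Q * A = A"
    using arg_cong[OF R(2), of mat_adjoint] mat_adjoint_mult[of "mat_adjoint A * R" n n "mat_adjoint A" m]
      A A' R Q QA by (simp add: mat_adjoint_adjoint assoc_mult_mat[of _ m n _ m _ n])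
  have QA_herm: "mat_adjoint (Q * A) = Q * A" using R(3) QA by simp
  define Z where "Z = Q * A * P"
  have Z: "Z \<in> carrier_mat n m" using A P Q by (simp add: Z_def)
  have AZ: "A * Z = A * P"
  proof -
    have "A * Z = A * Q * A * P" unfolding Z_def
      using A P Q by (simp add: assoc_mult_mat[of _ m n _ m _ m] assoc_mult_mat[of _ m n _ m _ n]
          assoc_mult_mat[of _ m n _ n _ m])
    then show ?thesis by (simp only: AQA)
  qed
  have ZA: "Z * A = Q * A"
  proof -
    have "Z * A = Q * (A * P * A)" unfolding Z_def
      using A P(1) Q by (simp add: assoc_mult_mat[of _ n m _ m _ n] assoc_mult_mat[of _ n m _ n _ m]
          assoc_mult_mat[of _ m n _ m _ n] assoc_mult_mat[of _ n n _ m _ n]  assoc_mult_mat[of _ n m _ n _ n])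
    then show ?thesis by (simp only: P(2))
  qed
  have "Z * A * Z = Z"
  proof -
    have "Z * A * Z = Q * (A * Z)" unfolding ZA using A Q Z by (simp add: assoc_mult_mat[of _ n m _ n _ m])
    also have "\<dots> = Z" unfolding AZ using A P(1) Q by (simp add: Z_def assoc_mult_mat[of _ n m _ n _ m])
    finally show ?thesis .
  qed
  moreover have "A * Z * A = A" using AZ P by simp
  ultimately have "is_pseudo_inverse A Z"
    unfolding is_pseudo_inverse_def using A Z AZ ZA P QA_herm by auto
  then show ?thesis by blast
qed

text \<open>In \<open>A P = (A Q) (A P)\<close> all factors are Hermitian, so taking adjoints gives
  \<open>A P = A P A Q = A Q\<close>. Likewise \<open>P A = Q A\<close>, whence
  \<open>P = P A P = Q A P = Q A Q = Q\<close>.\<close>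

lemma is_pseudo_inverse_unique:
  assumes "is_pseudo_inverse A P" "is_pseudo_inverse A Q"
  shows "P = Q"
proof -
  define m n where "m = dim_row A" and "n = dim_col A"
  have A: "A \<in> carrier_mat m n" by (simp add: m_def n_def)
  have P: "P \<in> carrier_mat n m" "A * P * A = A" "P * A * P = P"
      "mat_adjoint (A * P) = A * P" "mat_adjoint (P * A) = P * A"
    using assms(1) by (auto simp: is_pseudo_inverse_def m_def n_def)
  have Q: "Q \<in> carrier_mat n m" "A * Q * A = A" "Q * A * Q = Q"
      "mat_adjoint (A * Q) = A * Q" "mat_adjoint (Q * A) = Q * A"
    using assms(2) by (auto simp: is_pseudo_inverse_def m_def n_def)
  have "A * P = A * Q * (A * P)"
    using A P Q by (simp flip: assoc_mult_mat[of _ m n _ m _ m] assoc_mult_mat[of _ m m _ n _ m])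
  then have "mat_adjoint (A * P) = mat_adjoint (A * P) * mat_adjoint (A * Q)"
    using mat_adjoint_mult[of "A * Q" m m "A * P" m] A P Q by simp
  then have AP: "A * P = A * P * (A * Q)" using P Q by simp
  also have "\<dots> = A * P * A * Q"
    using A P(1) Q(1) by (intro assoc_mult_mat[symmetric, of _ m m _ n _ m]) auto
  finally have AP: "A * P = A * Q" using P by simp
  have "P * A * (Q * A) = P * (A * Q * A)"
    using A P(1) Q(1) by (simp add: assoc_mult_mat[of _ n m _ n _ n] assoc_mult_mat[of _ m n _ m _ n])
  then have "P * A = P * A * (Q * A)" using Q(2) by simp
  then have "mat_adjoint (P * A) = mat_adjoint (Q * A) * mat_adjoint (P * A)"
    using mat_adjoint_mult[of "P * A" n n "Q * A" n] A P Q by simp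
  then have "P * A = Q * A * (P * A)" using P Q by simp
  also have "\<dots> = Q * (A * P * A)"
    using A P(1) Q(1) by (simp add: assoc_mult_mat[of _ n m _ n _ n] assoc_mult_mat[of _ m n _ m _ n])
  finally have PA: "P * A = Q * A" using P by simp
  have "P = Q * A * P" using P PA by simp
  also have "\<dots> = Q * (A * P)" using A P(1) Q(1) by (simp add: assoc_mult_mat[of _ n m _ n _ m])
  also have "\<dots> = Q * A * Q" using A Q(1) unfolding AP by (simp add: assoc_mult_mat[of _ n m _ n _ m])
  finally show ?thesis using Q by simp
qed

lemma is_pseudo_inverse_pseudo_inverse: "is_pseudo_inverse A (pseudo_inverse A)"
proof -
  obtain P where "is_pseudo_inverse A P"
    using is_pseudo_inverse_exists[of A "dim_row A" "dim_col A"] by auto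
  then show ?thesis
    unfolding pseudo_inverse_def
    by (rule theI) (rule is_pseudo_inverse_unique[OF _ \<open>is_pseudo_inverse A P\<close>])
qed

section \<open>Minimum-norm solutions of linear systems\<close>

lemma mult_mat_vec_hermitian:
  fixes M :: "complex mat"
  assumes M: "M \<in> carrier_mat n n" "mat_adjoint M = M"
    and u: "u \<in> carrier_vec n" and w: "w \<in> carrier_vec n"
  shows "(\<Sum>j<n. (M *\<^sub>v u) $ j * cnj (w $ j)) = (\<Sum>j<n. u $ j * cnj ((M *\<^sub>v w) $ j))"
proof -
  have M': "M $$ (j, k) * u $ k * cnj (w $ j) = u $ k * cnj (M $$ (k, j) * w $ j)"
    if "j < n" "k < n" for j k
    using mat_adjoint_index[OF M(1) that] M(2) by simp
  have "(\<Sum>j<n. (M *\<^sub>v u) $ j * cnj (w $ j)) = (\<Sum>j<n. \<Sum>k<n. M $$ (j, k) * u $ k * cnj (w $ j))"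
    using mult_mat_vec_index[OF M(1) u] by (simp add: sum_distrib_right)
  also have "\<dots> = (\<Sum>k<n. \<Sum>j<n. M $$ (j, k) * u $ k * cnj (w $ j))"
    by (rule sum.swap)
  also have "\<dots> = (\<Sum>k<n. u $ k * cnj (\<Sum>j<n. M $$ (k, j) * w $ j))"
    unfolding cnj_sum sum_distrib_left
    by (intro sum.cong refl) (rule M', auto)
  also have "\<dots> = (\<Sum>k<n. u $ k * cnj ((M *\<^sub>v w) $ k))"
    using mult_mat_vec_index[OF M(1) w] by simp
  finally show ?thesis .
qed

text \<open>The left-hand vector is the minimum-norm solution \<open>x\<close> of \<open>X x = X u\<close>.\<close>

lemma pseudo_inverse_mult_eq_iff:
  assumes X: "X \<in> carrier_mat m n" and u: "u \<in> carrier_vec n"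
  shows "pseudo_inverse X *\<^sub>v (X *\<^sub>v u) = u \<longleftrightarrow>
    (\<forall>a \<in> carrier_vec n. X *\<^sub>v a = 0\<^sub>v m \<longrightarrow> (\<Sum>j<n. u $ j * cnj (a $ j)) = 0)"
proof -
  define P where "P = pseudo_inverse X"
  have P: "P \<in> carrier_mat n m" "X * P * X = X" "mat_adjoint (P * X) = P * X"
    using is_pseudo_inverse_pseudo_inverse[of X] X by (auto simp: P_def is_pseudo_inverse_def)
  \<comment> \<open>The orthogonal projection onto the orthogonal complement of the kernel of
    \<open>X\<close>; the question becomes when \<open>M\<close> fixes \<open>u\<close>.\<close>
  define M where "M = P * X"
  have M: "M \<in> carrier_mat n n" "mat_adjoint M = M" using P X by (auto simp: M_def)
  have Mv: "P *\<^sub>v (X *\<^sub>v a) = M *\<^sub>v a" if "a \<in> carrier_vec n" for a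
    using P X that by (simp add: M_def)
  have M_ker: "M *\<^sub>v a = 0\<^sub>v n" if "a \<in> carrier_vec n" "X *\<^sub>v a = 0\<^sub>v m" for a
  proof -
    have "P *\<^sub>v 0\<^sub>v m = 0\<^sub>v n" using P(1) by (intro eq_vecI) (auto simp: scalar_prod_def)
    then show ?thesis using Mv[OF that(1)] that(2) by simp
  qed
  have M_ker_orth: "(\<Sum>j<n. (M *\<^sub>v u) $ j * cnj (a $ j)) = 0"
    if "a \<in> carrier_vec n" "X *\<^sub>v a = 0\<^sub>v m" for a
    unfolding mult_mat_vec_hermitian[OF M u that(1)] M_ker[OF that] by simp
  have XM: "X *\<^sub>v (M *\<^sub>v u) = X *\<^sub>v u"
  proof -
    have "X *\<^sub>v (M *\<^sub>v u) = (X * M) *\<^sub>v u" using X M u by simp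
    also have "X * M = X" using P assoc_mult_mat[OF X P(1) X] by (simp add: M_def)
    finally show ?thesis .
  qed
  show ?thesis unfolding P_def[symmetric] Mv[OF u]
  proof
    assume "M *\<^sub>v u = u"
    then show "\<forall>a \<in> carrier_vec n. X *\<^sub>v a = 0\<^sub>v m \<longrightarrow> (\<Sum>j<n. u $ j * cnj (a $ j)) = 0"
      using M_ker_orth by metis
  next
    assume orth: "\<forall>a \<in> carrier_vec n. X *\<^sub>v a = 0\<^sub>v m \<longrightarrow> (\<Sum>j<n. u $ j * cnj (a $ j)) = 0"
    \<comment> \<open>The kernel component of \<open>u\<close>. It is orthogonal to \<open>u\<close>
      by assumption and to \<open>M u\<close> by \<open>M_ker_orth\<close>, hence to itself.\<close>
    define w where "w = u - M *\<^sub>v u"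
    have w: "w \<in> carrier_vec n" using M u by (simp add: w_def)
    have "X *\<^sub>v w = X *\<^sub>v u - X *\<^sub>v (M *\<^sub>v u)"
      unfolding w_def using X M u by (intro mult_minus_distrib_mat_vec) auto
    then have Xw: "X *\<^sub>v w = 0\<^sub>v m" using X u by (simp add: XM)
    have "(\<Sum>j<n. w $ j * cnj (w $ j)) =
        (\<Sum>j<n. u $ j * cnj (w $ j)) - (\<Sum>j<n. (M *\<^sub>v u) $ j * cnj (w $ j))"
      unfolding sum_subtractf[symmetric]
      using M by (intro sum.cong) (auto simp: w_def left_diff_distrib)
    also have "\<dots> = 0" using orth w Xw M_ker_orth[OF w Xw] by simp
    finally have "(\<Sum>j<n. complex_of_real ((cmod (w $ j))\<^sup>2)) = 0"
      by (simp add: complex_norm_square del: of_real_power)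
    then have "(\<Sum>j<n. (cmod (w $ j))\<^sup>2) = 0"
      by (metis of_real_sum of_real_eq_0_iff)
    then have w0: "\<And>j. j < n \<Longrightarrow> w $ j = 0"
      by (subst (asm) sum_nonneg_eq_0_iff) auto
    show "M *\<^sub>v u = u"
    proof (rule eq_vecI)
      fix j assume "j < dim_vec u"
      then show "(M *\<^sub>v u) $ j = u $ j" using w0[of j] u M by (simp add: w_def)
    qed (use M u in auto)
  qed
qed

section \<open>Spectra of companion matrices and roots of unity\<close>

lemma spectrum_transpose:
  fixes A :: "'a::field mat"
  assumes A: "A \<in> carrier_mat n n"
  shows "spectrum (transpose_mat A) = spectrum A"
  using spectrum_root_char_poly[OF A] spectrum_root_char_poly[of "transpose_mat A" n] A by simp

text \<open>The transpose acts as the shift of a linear recurrence with coefficients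
  \<open>c\<close>, which makes its eigenvectors geometric sequences.\<close>

lemma transpose_companion_mult_vec:
  assumes c: "c \<in> carrier_vec n" and w: "w \<in> carrier_vec n" and j: "j < n"
  shows "(transpose_mat (companion c) *\<^sub>v w) $ j =
    (if j + 1 = n then \<Sum>i<n. c $ i * w $ i else w $ (j + 1))"
proof -
  have C: "transpose_mat (companion c) \<in> carrier_mat n n" using c by (simp add: companion_def)
  have "(transpose_mat (companion c) *\<^sub>v w) $ j =
      (\<Sum>i<n. (if j + 1 = n then c $ i else if i = j + 1 then 1 else 0) * w $ i)"
    unfolding mult_mat_vec_index[OF C w j]
    using c j by (intro sum.cong) (auto simp: companion_def)
  then show ?thesis using j by (auto simp: if_distrib[of "\<lambda>x. x * _"] cong: if_cong)
qed

text \<open>A left eigenvector of the companion matrix for \<open>z\<close> is a multiple of \<open>(1, z, z^2, \<dots>)\<close>.\<close>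

lemma spectrum_companion:
  assumes c: "c \<in> carrier_vec n" and n: "n \<ge> 1"
  shows "spectrum (companion c) = {z. z ^ n = (\<Sum>i<n. c $ i * z ^ i)}"
proof -
  define T where "T = transpose_mat (companion c)"
  have C: "companion c \<in> carrier_mat n n" using c by (simp add: companion_def)
  then have T: "T \<in> carrier_mat n n" by (simp add: T_def)
  have T_index: "(T *\<^sub>v w) $ j = (if j + 1 = n then \<Sum>i<n. c $ i * w $ i else w $ (j + 1))"
    if "w \<in> carrier_vec n" "j < n" for w j
    unfolding T_def by (rule transpose_companion_mult_vec[OF c that])
  have "eigenvalue T z \<longleftrightarrow> z ^ n = (\<Sum>i<n. c $ i * z ^ i)" for z
  proof
    assume "eigenvalue T z"
    then obtain w where w: "w \<in> carrier_vec n" "w \<noteq> 0\<^sub>v n" "T *\<^sub>v w = z \<cdot>\<^sub>v w"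
      using T by (auto simp: eigenvalue_def eigenvector_def)
    have rec: "(T *\<^sub>v w) $ j = z * w $ j" if "j < n" for j using w that by simp
    have pow: "w $ j = z ^ j * w $ 0" if "j < n" for j
      using that
    proof (induction j)
      case (Suc j)
      then show ?case using rec[of j] T_index[OF w(1), of j] by simp
    qed simp
    have w0: "w $ 0 \<noteq> 0"
    proof
      assume "w $ 0 = 0"
      then have "w = 0\<^sub>v n" using w pow by (intro eq_vecI) auto
      then show False using w by simp
    qed
    have "(\<Sum>i<n. c $ i * w $ i) = z * w $ (n - 1)"
      using rec[of "n - 1"] T_index[OF w(1), of "n - 1"] n by simp
    also have "\<dots> = z ^ n * w $ 0" using pow[of "n - 1"] n by (cases n) auto
    also have "(\<Sum>i<n. c $ i * w $ i) = (\<Sum>i<n. c $ i * z ^ i) * w $ 0"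
      unfolding sum_distrib_right by (intro sum.cong refl) (metis lessThan_iff mult.assoc pow)
    finally have "(\<Sum>i<n. c $ i * z ^ i) * w $ 0 = z ^ n * w $ 0" .
    then show "z ^ n = (\<Sum>i<n. c $ i * z ^ i)" using w0 by simp
  next
    assume z: "z ^ n = (\<Sum>i<n. c $ i * z ^ i)"
    define w where "w = vec n (\<lambda>i. z ^ i)"
    have w: "w \<in> carrier_vec n" by (simp add: w_def)
    have "w $ 0 \<noteq> 0\<^sub>v n $ 0" using n by (simp add: w_def)
    then have "w \<noteq> 0\<^sub>v n" by metis
    moreover have "T *\<^sub>v w = z \<cdot>\<^sub>v w"
    proof (rule eq_vecI)
      fix j assume "j < dim_vec (z \<cdot>\<^sub>v w)"
      then have j: "j < n" by (simp add: w_def)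
      have "z * z ^ j = z ^ n" if "j + 1 = n" using that by auto
      then show "(T *\<^sub>v w) $ j = (z \<cdot>\<^sub>v w) $ j"
        using T_index[OF w j] j z by (simp add: w_def)
    qed (use T w in auto)
    ultimately show "eigenvalue T z" using w T by (auto simp: eigenvalue_def eigenvector_def)
  qed
  then show ?thesis
    using spectrum_transpose[OF C] unfolding spectrum_def T_def by auto
qed

text \<open>Both sides say \<open>1 + z + ... + z^n = 0\<close>; the right one is the eigenvalue
  equation of the companion matrix whose last column is constantly \<open>-1\<close>. At
  \<open>z = 1\<close> the sum is \<open>n + 1\<close>, nonzero in characteristic zero.\<close>

lemma nontrivial_root_unity_iff:
  fixes z :: "'a::field_char_0"
  shows "z \<noteq> 1 \<and> z ^ (n + 1) = 1 \<longleftrightarrow> z ^ n = (\<Sum>i<n. (-1) * z ^ i)"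
proof -
  have "z \<noteq> 1 \<and> z ^ (n + 1) = 1 \<longleftrightarrow> (\<Sum>i<Suc n. z ^ i) = 0"
  proof (cases "z = 1")
    case True
    then show ?thesis using of_nat_neq_0[of n, where ?'a='a] by simp
  next
    case False
    then show ?thesis by (simp add: geometric_sum del: sum.lessThan_Suc)
  qed
  also have "\<dots> \<longleftrightarrow> z ^ n = - (\<Sum>i<n. z ^ i)"
    by (simp add: eq_neg_iff_add_eq_0 add.commute)
  also have "- (\<Sum>i<n. z ^ i) = (\<Sum>i<n. (-1) * z ^ i)" by (simp add: sum_negf)
  finally show ?thesis .
qed

text \<open>If the sets agree, subtracting the two equations for \<open>z ^ n\<close> leaves a
  polynomial of degree below \<open>n\<close> with coefficients \<open>c $ i + 1\<close>. It
  vanishes at all \<open>n\<close> nontrivial roots of unity, so it is zero.\<close>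

lemma spectrum_companion_eq_roots_unity_iff:
  assumes c: "c \<in> carrier_vec n" and n: "n \<ge> 1"
  shows "spectrum (companion c) = {z. z \<noteq> 1 \<and> z ^ (n + 1) = 1} \<longleftrightarrow> (\<forall>i<n. c $ i = -1)"
proof
  assume "\<forall>i<n. c $ i = -1"
  then show "spectrum (companion c) = {z. z \<noteq> 1 \<and> z ^ (n + 1) = 1}"
    unfolding spectrum_companion[OF c n] nontrivial_root_unity_iff by simp
next
  assume eq: "spectrum (companion c) = {z. z \<noteq> 1 \<and> z ^ (n + 1) = 1}" (is "_ = ?S")
  have "?S = {z. z ^ (n + 1) = 1} - {1}" by auto
  then have card: "card ?S = n" using card_roots_unity_eq[of "n + 1"] by simp
  define p where "p = (\<Sum>i<n. monom (c $ i + 1) i)"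
  have roots: "?S \<subseteq> {z. poly p z = 0}"
  proof
    fix z assume z: "z \<in> ?S"
    then have "z ^ n = (\<Sum>i<n. (-1) * z ^ i)" unfolding nontrivial_root_unity_iff by simp
    moreover have "z ^ n = (\<Sum>i<n. c $ i * z ^ i)"
      using z unfolding eq[symmetric] spectrum_companion[OF c n] by simp
    ultimately have "(\<Sum>i<n. c $ i * z ^ i) - (\<Sum>i<n. (-1) * z ^ i) = 0" by simp
    then show "z \<in> {z. poly p z = 0}"
      unfolding sum_subtractf[symmetric] by (simp add: p_def poly_sum poly_monom ring_distribs)
  qed
  have "p = 0"
  proof (rule ccontr)
    assume p: "p \<noteq> 0"
    have "degree p < n"
      unfolding p_def using n by (intro degree_sum_less) (auto intro: le_less_trans[OF degree_monom_le])
    moreover have "n \<le> card {z. poly p z = 0}"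
      using card_mono[OF poly_roots_finite[OF p] roots] card by simp
    ultimately show False using card_poly_roots_bound[OF p] by simp
  qed
  have "coeff p i = c $ i + 1" if "i < n" for i
    using that by (simp add: p_def coeff_sum)
  then show "\<forall>i<n. c $ i = -1" using \<open>p = 0\<close> by (simp add: eq_neg_iff_add_eq_0)
qed

section \<open>The DFT criterion as a condition on linear relations between snapshots\<close>

text \<open>Solutions \<open>a\<close> of \<open>X a = 0\<close> and coefficients \<open>b\<close> as below correspond via
  \<open>a\<^sub>j = b\<^sub>j - b\<^sub>n\<close>, which makes \<open>\<Sum>\<^sub>j a\<^sub>j\<close> equal to \<open>-(n+1) b\<^sub>n\<close>.\<close>

lemma ms_dmd_equiv_dft_iff:
  assumes n: "n \<ge> 1"
  shows "ms_dmd_equiv_dft \<Gamma> \<psi> v n \<longleftrightarrow>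
    (\<forall>b. (\<Sum>j<n+1. b j) = 0 \<and> (\<forall>i<dim_vec \<psi>. (\<Sum>j<n+1. b j * snapshot \<Gamma> \<psi> v j $ i) = 0) \<longrightarrow> b n = 0)"
proof -
  define m where "m = dim_vec \<psi>"
  define Z where "Z j i = snapshot \<Gamma> \<psi> v j $ i" for j i
  define \<mu> where "\<mu> i = snapshot_mean \<Gamma> \<psi> v n $ i" for i
  define X where "X = X_ms \<Gamma> \<psi> v n"
  define u where "u = vec n (\<lambda>_. -1 :: complex)"
  have dims [simp]: "dim_vec (snapshot \<Gamma> \<psi> v j) = m" "dim_vec (snapshot_mean \<Gamma> \<psi> v n) = m" for j
    by (simp_all add: m_def snapshot_def eval_vec_def snapshot_mean_def)
  have mean: "(\<Sum>j<n+1. Z j i) = of_nat (n + 1) * \<mu> i" if "i < m" for i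
    using that of_nat_neq_0[of n, where ?'a=complex]
    by (simp add: \<mu>_def Z_def snapshot_mean_def m_def del: sum.lessThan_Suc of_nat_Suc)
  have centered: "(\<Sum>j<n+1. Z j i - \<mu> i) = 0" if "i < m" for i
    using mean[OF that] by (simp add: sum_subtractf del: sum.lessThan_Suc)
  have X: "X \<in> carrier_mat m n" unfolding X_def X_ms_def m_def by (rule carrier_matI) simp_all
  have X_index: "X $$ (i, j) = Z j i - \<mu> i" if "i < m" "j < n" for i j
    using that by (simp add: X_def X_ms_def m_def[symmetric] mat_of_cols_index Z_def \<mu>_def)
  have X_mult: "(X *\<^sub>v a) $ i = (\<Sum>j<n. (Z j i - \<mu> i) * a $ j)" if "a \<in> carrier_vec n" "i < m" for a i
    unfolding mult_mat_vec_index[OF X that] using X_index that by simp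
  have u: "u \<in> carrier_vec n" by (simp add: u_def)
  have "X *\<^sub>v u = snapshot \<Gamma> \<psi> v n - snapshot_mean \<Gamma> \<psi> v n"
  proof (rule eq_vecI)
    fix i assume "i < dim_vec (snapshot \<Gamma> \<psi> v n - snapshot_mean \<Gamma> \<psi> v n)"
    then have i: "i < m" by simp
    have "(X *\<^sub>v u) $ i = - (\<Sum>j<n. Z j i - \<mu> i)"
      unfolding X_mult[OF u i] by (simp add: u_def sum_negf[symmetric])
    also have "\<dots> = Z n i - \<mu> i" using centered[OF i] by (simp add: add_eq_0_iff)
    finally show "(X *\<^sub>v u) $ i = (snapshot \<Gamma> \<psi> v n - snapshot_mean \<Gamma> \<psi> v n) $ i"
      using i by (simp add: Z_def \<mu>_def)
  qed (use X in auto)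
  then have c: "c_ms \<Gamma> \<psi> v n = pseudo_inverse X *\<^sub>v (X *\<^sub>v u)"
    by (simp add: c_ms_def X_def)
  have "pseudo_inverse X \<in> carrier_mat n m"
    using is_pseudo_inverse_pseudo_inverse[of X] X by (auto simp: is_pseudo_inverse_def)
  then have c_carrier: "c_ms \<Gamma> \<psi> v n \<in> carrier_vec n"
    unfolding c using X u by (intro mult_mat_vec_carrier[of _ n m]) auto
  have "ms_dmd_equiv_dft \<Gamma> \<psi> v n \<longleftrightarrow> (\<forall>i<n. c_ms \<Gamma> \<psi> v n $ i = -1)"
    unfolding ms_dmd_equiv_dft_def ms_dmd_eigenvalues_def
    by (rule spectrum_companion_eq_roots_unity_iff[OF c_carrier n])
  also have "\<dots> \<longleftrightarrow> c_ms \<Gamma> \<psi> v n = u"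
    using c_carrier by (auto simp: u_def)
  also have "\<dots> \<longleftrightarrow> (\<forall>a \<in> carrier_vec n. X *\<^sub>v a = 0\<^sub>v m \<longrightarrow> (\<Sum>j<n. u $ j * cnj (a $ j)) = 0)"
    unfolding c by (rule pseudo_inverse_mult_eq_iff[OF X u])
  also have "\<dots> \<longleftrightarrow> (\<forall>a \<in> carrier_vec n. X *\<^sub>v a = 0\<^sub>v m \<longrightarrow> (\<Sum>j<n. a $ j) = 0)"
  proof -
    have "(\<Sum>j<n. u $ j * cnj (a $ j)) = - cnj (\<Sum>j<n. a $ j)" for a
      by (simp add: u_def sum_negf)
    then show ?thesis by (simp del: cnj_sum)
  qed
  also have "\<dots> \<longleftrightarrow> (\<forall>b. (\<Sum>j<n+1. b j) = 0 \<and> (\<forall>i<m. (\<Sum>j<n+1. b j * Z j i) = 0) \<longrightarrow> b n = 0)"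
    (is "?L \<longleftrightarrow> ?R")
  proof
    assume L: ?L
    show ?R
    proof (intro allI impI)
      fix b assume b: "(\<Sum>j<n+1. b j) = 0 \<and> (\<forall>i<m. (\<Sum>j<n+1. b j * Z j i) = 0)"
      define a where "a = vec n (\<lambda>j. b j - b n)"
      have a: "a \<in> carrier_vec n" by (simp add: a_def)
      have "X *\<^sub>v a = 0\<^sub>v m"
      proof (rule eq_vecI)
        fix i assume "i < dim_vec (0\<^sub>v m)"
        then have i: "i < m" by simp
        \<comment> \<open>The sum may run up to \<open>j = n\<close> because the added term contains
          \<open>b n - b n\<close>; only the full sum can use \<open>centered\<close>.\<close>
        have "(X *\<^sub>v a) $ i = (\<Sum>j<n+1. (Z j i - \<mu> i) * (b j - b n))"
          unfolding X_mult[OF a i] by (simp add: a_def)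
        also have "\<dots> = (\<Sum>j<n+1. b j * Z j i) - \<mu> i * (\<Sum>j<n+1. b j) - b n * (\<Sum>j<n+1. Z j i - \<mu> i)"
          unfolding sum_distrib_left sum_subtractf[symmetric]
          by (intro sum.cong) (auto simp: algebra_simps)
        also have "\<dots> = 0" using b centered[OF i] i by (simp del: sum.lessThan_Suc)
        finally show "(X *\<^sub>v a) $ i = 0\<^sub>v m $ i" using i by simp
      qed (use X in auto)
      then have "(\<Sum>j<n. a $ j) = 0" using L a by blast
      then have "(\<Sum>j<n. b j - b n) = 0" by (simp add: a_def)
      then have "(\<Sum>j<n+1. b j) - of_nat (n + 1) * b n = 0"
        by (simp add: sum_subtractf algebra_simps)
      then show "b n = 0" using b of_nat_neq_0[of n, where ?'a=complex]
        by (simp del: sum.lessThan_Suc of_nat_Suc)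
    qed
  next
    assume R: ?R
    show ?L
    proof (intro ballI impI)
      fix a assume a: "a \<in> carrier_vec n" and Xa: "X *\<^sub>v a = 0\<^sub>v m"
      define s where "s = (\<Sum>j<n. a $ j)"
      \<comment> \<open>Inverse of the substitution above: \<open>a\<close> is extended by 0 at
        index \<open>n\<close> and shifted by its mean over \<open>n + 1\<close> entries, so that
        \<open>b\<close> sums to zero and \<open>b n = - s / (n + 1)\<close>.\<close>
      define b where "b j = (if j < n then a $ j else 0) - s / of_nat (n + 1)" for j
      have n1: "of_nat (n + 1) \<noteq> (0 :: complex)" using of_nat_neq_0[of n, where ?'a=complex] by simp
      \<comment> \<open>The weight \<open>f\<close> is instantiated with the constant 1 and with
        \<open>Z j i\<close>, one for each condition on \<open>b\<close>.\<close>
      have b_sum: "(\<Sum>j<n+1. b j * f j) = (\<Sum>j<n. a $ j * f j) - s / of_nat (n + 1) * (\<Sum>j<n+1. f j)" for f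
        unfolding b_def left_diff_distrib sum_subtractf sum_distrib_left by simp
      have "(\<Sum>j<n+1. b j * 1) = 0"
        unfolding b_sum using n1 by (simp add: s_def del: of_nat_Suc of_nat_add sum.lessThan_Suc)
      moreover have "(\<Sum>j<n+1. b j * Z j i) = 0" if i: "i < m" for i
      proof -
        have "(\<Sum>j<n+1. b j * Z j i) = (\<Sum>j<n. a $ j * Z j i) - s * \<mu> i"
          unfolding b_sum mean[OF i] using n1 by (simp del: of_nat_Suc of_nat_add)
        also have "\<dots> = (X *\<^sub>v a) $ i"
          unfolding X_mult[OF a i] by (simp add: s_def right_diff_distrib sum_subtractf sum_distrib_left mult.commute)
        finally show ?thesis using Xa i by simp
      qed
      ultimately have "b n = 0" using R by simp
      then show "(\<Sum>j<n. a $ j) = 0" using n1 by (simp add: b_def s_def del: of_nat_Suc of_nat_add)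
    qed
  qed
  finally show ?thesis unfolding Z_def m_def .
qed

section \<open>From relations between snapshots to polynomials vanishing at the eigenvalues\<close>

lemma poly_eq_sum_coeff:
  fixes p :: "'a::comm_semiring_1 poly"
  assumes "degree p < n"
  shows "poly p x = (\<Sum>j<n. coeff p j * x ^ j)"
  unfolding poly_altdef using assms by (intro sum.mono_neutral_left) (auto simp: coeff_eq_0)

text \<open>The vector \<open>\<Sum>\<^sub>k q(l\<^sub>k) u\<^sub>k\<close> stands for \<open>q(A)\<close> applied to \<open>\<Sum>\<^sub>k u\<^sub>k\<close>. Its vanishing is therefore
  inherited by all multiples of \<open>q\<close>, in particular by the one that vanishes at all nodes but one.\<close>

lemma poly_eq_0_at_eigenvalues:
  fixes A u :: "nat \<Rightarrow> nat \<Rightarrow> 'a::field"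
  assumes inj: "inj_on l {..<r}"
    and inv: "\<And>j i. i < m \<Longrightarrow>
      (\<Sum>t<m. A i t * (\<Sum>k<r. l k ^ j * u k t)) = (\<Sum>k<r. l k ^ Suc j * u k i)"
    and nz: "\<And>k. k < r \<Longrightarrow> \<exists>i<m. u k i \<noteq> 0"
    and q: "\<And>i. i < m \<Longrightarrow> (\<Sum>k<r. poly q (l k) * u k i) = 0"
    and k: "k < r"
  shows "poly q (l k) = 0"
proof -
  define Q where "Q p i = (\<Sum>k<r. poly p (l k) * u k i)" for p i
  \<comment> \<open>Applying \<open>A\<close> to \<open>Q p\<close> multiplies \<open>p\<close> by
    the indeterminate. By linearity in the coefficients of \<open>p\<close> this reduces to
    \<open>inv\<close> for each power.\<close>
  have step: "(\<Sum>t<m. A i t * Q p t) = Q (pCons 0 p) i" if i: "i < m" for p i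
  proof -
    have "(\<Sum>t<m. A i t * Q p t) =
        (\<Sum>t<m. \<Sum>k<r. \<Sum>j\<le>degree p. A i t * (coeff p j * (l k ^ j * u k t)))"
      unfolding Q_def poly_altdef by (simp add: sum_distrib_left sum_distrib_right mult_ac)
    also have "\<dots> = (\<Sum>t<m. \<Sum>j\<le>degree p. \<Sum>k<r. A i t * (coeff p j * (l k ^ j * u k t)))"
      by (rule sum.cong[OF refl]) (rule sum.swap)
    also have "\<dots> = (\<Sum>j\<le>degree p. \<Sum>t<m. \<Sum>k<r. A i t * (coeff p j * (l k ^ j * u k t)))"
      by (rule sum.swap)
    also have "\<dots> = (\<Sum>j\<le>degree p. coeff p j * (\<Sum>t<m. A i t * (\<Sum>k<r. l k ^ j * u k t)))"
      by (simp add: sum_distrib_left mult_ac)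
    also have "\<dots> = (\<Sum>j\<le>degree p. \<Sum>k<r. coeff p j * (l k ^ Suc j * u k i))"
      by (intro sum.cong refl) (subst inv[OF i], rule sum_distrib_left)
    also have "\<dots> = (\<Sum>k<r. \<Sum>j\<le>degree p. coeff p j * (l k ^ Suc j * u k i))"
      by (rule sum.swap)
    also have "\<dots> = Q (pCons 0 p) i"
      by (simp add: Q_def poly_altdef[of p] sum_distrib_left sum_distrib_right mult_ac)
    finally show ?thesis .
  qed
  \<comment> \<open>Induction on \<open>s\<close> via \<open>(a + x s) q = a q + x (s q)\<close>:
    the second summand is \<open>A\<close> applied to a zero vector, for which all components
    \<open>i\<close> are needed at once.\<close>
  have mult: "Q (s * q) i = 0" if "i < m" for s i
    using that
  proof (induction s arbitrary: i)
    case 0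
    then show ?case by (simp add: Q_def)
  next
    case (pCons a s)
    have "Q (pCons a s * q) i = a * Q q i + Q (pCons 0 (s * q)) i"
      by (simp add: Q_def sum.distrib sum_distrib_left algebra_simps)
    also have "Q (pCons 0 (s * q)) i = 0"
      unfolding step[OF pCons.prems, symmetric] using pCons.IH by simp
    finally show ?case using q[OF pCons.prems] by (simp add: Q_def)
  qed
  define s where "s = (\<Prod>j\<in>{..<r} - {k}. [:- l j, 1:])"
  have s_other: "poly s (l j) = 0" if "j < r" "j \<noteq> k" for j
    unfolding s_def poly_prod using that by (intro prod_zero) auto
  have s_k: "poly s (l k) \<noteq> 0"
    unfolding s_def poly_prod using inj_onD[OF inj] k by auto
  obtain i where i: "i < m" "u k i \<noteq> 0" using nz[OF k] by blast
  have "Q (s * q) i = (\<Sum>j<r. if j = k then poly s (l k) * poly q (l k) * u k i else 0)"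
    unfolding Q_def using s_other by (intro sum.cong) auto
  also have "\<dots> = poly s (l k) * poly q (l k) * u k i" using k by simp
  finally show ?thesis using mult[OF i(1), of s] s_k i by simp
qed

lemma eval_vec_carrier: "eval_vec \<phi> x \<in> carrier_vec (dim_vec \<phi>)"
  by (rule carrier_vecI) (simp add: eval_vec_def)

lemma eigenfunction_iterate:
  assumes "koopman_eigenfunction \<Gamma> H l f"
  shows "f ((\<Gamma> ^^ j) v) = l ^ j * f v"
proof (induction j)
  case (Suc j)
  have "f (\<Gamma> x) = l * f x" for x
    using assms by (metis comp_apply koopman_def koopman_eigenfunction_def)
  then show ?case using Suc by simp
qed simp

text \<open>Snapshot \<open>j\<close> is the sum of \<open>l k ^ j\<close> times a fixed vector
  \<open>u k\<close>, so the combination equals the sum of \<open>poly p (l k)\<close> times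
  \<open>u k\<close>. Koopman invariance, through \<open>poly_eq_0_at_eigenvalues\<close>, separates
  the terms.\<close>

lemma snapshot_combination_eq_0_iff:
  assumes \<psi>: "dictionary H m \<psi>" and span: "nonredundant_span \<Gamma> H m r l \<phi> \<psi>"
    and inf: "spectrally_informative \<phi> v" and inv: "koopman_invariant \<Gamma> m \<psi>"
    and p: "degree p < n"
  shows "(\<forall>i<dim_vec \<psi>. (\<Sum>j<n. coeff p j * snapshot \<Gamma> \<psi> v j $ i) = 0) \<longleftrightarrow>
    (\<forall>k<r. poly p (l k) = 0)"
proof -
  have m: "dim_vec \<psi> = m" using \<psi> by (auto simp: dictionary_def)
  obtain C where C: "C \<in> carrier_mat m r" "\<And>x. eval_vec \<psi> x = C *\<^sub>v eval_vec \<phi> x"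
    and col: "\<And>k. k < r \<Longrightarrow> col C k \<noteq> 0\<^sub>v m"
    using span by (auto simp: nonredundant_span_def)
  have \<phi>: "dim_vec \<phi> = r" and inj: "inj_on l {..<r}"
    and eig: "\<And>k. k < r \<Longrightarrow> koopman_eigenfunction \<Gamma> H (l k) (\<phi> $ k)"
    using span by (auto simp: nonredundant_span_def)
  obtain A where A: "A \<in> carrier_mat m m" "\<And>x. eval_vec (map_vec (koopman \<Gamma>) \<psi>) x = A *\<^sub>v eval_vec \<psi> x"
    using inv by (auto simp: koopman_invariant_def)
  \<comment> \<open>The contribution of eigenfunction \<open>k\<close> to the initial snapshot;
    nonzero since column \<open>k\<close> of \<open>C\<close> and the value of the eigenfunction at
    \<open>v\<close> are.\<close>
  define u where "u k i = C $$ (i, k) * (\<phi> $ k) v" for k i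
  have snap: "snapshot \<Gamma> \<psi> v j $ i = (\<Sum>k<r. l k ^ j * u k i)" if "i < m" for i j
  proof -
    have "eval_vec \<phi> ((\<Gamma> ^^ j) v) \<in> carrier_vec r" using eval_vec_carrier[of \<phi>] \<phi> by simp
    then have "snapshot \<Gamma> \<psi> v j $ i = (\<Sum>k<r. C $$ (i, k) * eval_vec \<phi> ((\<Gamma> ^^ j) v) $ k)"
      unfolding snapshot_def C(2) by (rule mult_mat_vec_index[OF C(1) _ that])
    also have "\<dots> = (\<Sum>k<r. l k ^ j * u k i)"
      using \<phi> by (intro sum.cong) (auto simp: eval_vec_def u_def eigenfunction_iterate[OF eig])
    finally show ?thesis .
  qed
  have snap_Suc: "(\<Sum>t<m. A $$ (i, t) * snapshot \<Gamma> \<psi> v j $ t) = snapshot \<Gamma> \<psi> v (Suc j) $ i"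
    if "i < m" for i j
  proof -
    have "snapshot \<Gamma> \<psi> v (Suc j) $ i = eval_vec (map_vec (koopman \<Gamma>) \<psi>) ((\<Gamma> ^^ j) v) $ i"
      using that m by (simp add: snapshot_def eval_vec_def koopman_def)
    also have "\<dots> = (A *\<^sub>v snapshot \<Gamma> \<psi> v j) $ i" by (simp add: A(2) snapshot_def)
    also have "\<dots> = (\<Sum>t<m. A $$ (i, t) * snapshot \<Gamma> \<psi> v j $ t)"
      using eval_vec_carrier[of \<psi>] m that by (intro mult_mat_vec_index[OF A(1)]) (simp_all add: snapshot_def)
    finally show ?thesis by simp
  qed
  have A_step: "(\<Sum>t<m. A $$ (i, t) * (\<Sum>k<r. l k ^ j * u k t)) = (\<Sum>k<r. l k ^ Suc j * u k i)"
    if "i < m" for i j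
  proof -
    have "(\<Sum>t<m. A $$ (i, t) * (\<Sum>k<r. l k ^ j * u k t)) = (\<Sum>t<m. A $$ (i, t) * snapshot \<Gamma> \<psi> v j $ t)"
      by (intro sum.cong refl arg_cong2[of _ _ _ _ "(*)"]) (rule snap[symmetric], simp)
    then show ?thesis unfolding snap_Suc[OF that] snap[OF that] .
  qed
  have u_nz: "\<exists>i<m. u k i \<noteq> 0" if k: "k < r" for k
  proof (rule ccontr)
    assume "\<not> (\<exists>i<m. u k i \<noteq> 0)"
    moreover have "(\<phi> $ k) v \<noteq> 0" using inf k \<phi> by (simp add: spectrally_informative_def)
    ultimately have "col C k = 0\<^sub>v m" using C(1) k by (intro eq_vecI) (auto simp: u_def)
    then show False using col[OF k] by simp
  qed
  have comb: "(\<Sum>j<n. coeff p j * snapshot \<Gamma> \<psi> v j $ i) = (\<Sum>k<r. poly p (l k) * u k i)" if "i < m" for i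
    unfolding snap[OF that] poly_eq_sum_coeff[OF p] sum_distrib_left sum_distrib_right
    by (subst sum.swap) (simp add: mult.assoc)
  show ?thesis
  proof
    assume 0: "\<forall>i<dim_vec \<psi>. (\<Sum>j<n. coeff p j * snapshot \<Gamma> \<psi> v j $ i) = 0"
    have "(\<Sum>k<r. poly p (l k) * u k i) = 0" if "i < m" for i
      using 0 m that comb[OF that] by simp
    then show "\<forall>k<r. poly p (l k) = 0"
      using poly_eq_0_at_eigenvalues[OF inj, of m "\<lambda>i t. A $$ (i, t)" u p] A_step u_nz by blast
  next
    assume "\<forall>k<r. poly p (l k) = 0"
    then show "\<forall>i<dim_vec \<psi>. (\<Sum>j<n. coeff p j * snapshot \<Gamma> \<psi> v j $ i) = 0"
      using comb m by simp
  qed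
qed

text \<open>The coefficients \<open>b\<close> become those of \<open>p\<close>. Their sum is
  \<open>poly p 1\<close>, so mean subtraction contributes 1 as an additional node.\<close>

lemma poly_ms_dmd_equiv_dft_iff:
  assumes "dictionary H m \<psi>" and "nonredundant_span \<Gamma> H m r l \<phi> \<psi>"
    and "spectrally_informative \<phi> v" and "koopman_invariant \<Gamma> m \<psi>" and n: "n \<ge> 1"
  shows "ms_dmd_equiv_dft \<Gamma> \<psi> v n \<longleftrightarrow>
    (\<forall>p. degree p \<le> n \<and> poly p 1 = 0 \<and> (\<forall>k<r. poly p (l k) = 0) \<longrightarrow> coeff p n = 0)"
    (is "_ \<longleftrightarrow> ?R")
proof -
  note comb = snapshot_combination_eq_0_iff[OF assms(1-4), where n = "n + 1"]
  show ?thesis unfolding ms_dmd_equiv_dft_iff[OF n]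
  proof (intro iffI allI impI)
    fix p :: "complex poly"
    assume L: "\<forall>b. (\<Sum>j<n+1. b j) = 0 \<and>
        (\<forall>i<dim_vec \<psi>. (\<Sum>j<n+1. b j * snapshot \<Gamma> \<psi> v j $ i) = 0) \<longrightarrow> b n = 0"
      and p: "degree p \<le> n \<and> poly p 1 = 0 \<and> (\<forall>k<r. poly p (l k) = 0)"
    then have "degree p < n + 1" by simp
    then show "coeff p n = 0"
      using L p comb[of p] poly_eq_sum_coeff[of p "n + 1" 1] by (auto simp del: sum.lessThan_Suc)
  next
    fix b :: "nat \<Rightarrow> complex"
    assume R: ?R
      and b: "(\<Sum>j<n+1. b j) = 0 \<and> (\<forall>i<dim_vec \<psi>. (\<Sum>j<n+1. b j * snapshot \<Gamma> \<psi> v j $ i) = 0)"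
    define p where "p = (\<Sum>j<n+1. monom (b j) j)"
    have deg: "degree p \<le> n"
      unfolding p_def by (rule degree_sum_le) (auto intro: order.trans[OF degree_monom_le])
    have coeff: "coeff p j = b j" if "j < n + 1" for j
      using that by (simp add: p_def coeff_sum del: sum.lessThan_Suc)
    have "poly p 1 = 0" using b by (simp add: p_def poly_sum poly_monom del: sum.lessThan_Suc)
    moreover have "\<forall>k<r. poly p (l k) = 0"
      using comb[of p] deg b coeff by (simp del: sum.lessThan_Suc cong: sum.cong_simp)
    ultimately show "b n = 0" using R deg coeff[of n] by auto
  qed
qed

theorem corollary4p5:
  fixes \<Gamma> :: "real ^ 'p \<Rightarrow> real ^ 'p"
    and H :: "(real ^ 'p \<Rightarrow> complex) set"
    and \<psi> \<phi> :: "(real ^ 'p \<Rightarrow> complex) vec"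
    and l :: "nat \<Rightarrow> complex"
    and v :: "real ^ 'p"
    and m n r :: nat
  assumes "observable_space \<Gamma> H"
    and "dictionary H m \<psi>"
    and "nonredundant_span \<Gamma> H m r l \<phi> \<psi>"
    and "spectrally_informative \<phi> v"
    and "koopman_invariant \<Gamma> m \<psi>"
    and "n \<ge> 1"
  shows "(n = r \<longrightarrow> (ms_dmd_equiv_dft \<Gamma> \<psi> v n \<longleftrightarrow> 1 \<notin> l ` {..<r})) \<and>
         (n < r \<longrightarrow> ms_dmd_equiv_dft \<Gamma> \<psi> v n)"
proof -
  note dft_iff = poly_ms_dmd_equiv_dft_iff[OF assms(2-6)]
  have card: "card (l ` {..<r}) = r"
    using assms(3) by (simp add: nonredundant_span_def card_image)
  \<comment> \<open>Covers both sufficient cases: the node set has \<open>r + 1\<close> elements if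
    1 is not an eigenvalue, and always at least \<open>r\<close>.\<close>
  have dft: "ms_dmd_equiv_dft \<Gamma> \<psi> v n" if "n < card (insert 1 (l ` {..<r}))"
    unfolding dft_iff
  proof (intro allI impI)
    fix p :: "complex poly"
    assume p: "degree p \<le> n \<and> poly p 1 = 0 \<and> (\<forall>k<r. poly p (l k) = 0)"
    have "p = 0"
    proof (rule ccontr)
      assume "p \<noteq> 0"
      have "card (insert 1 (l ` {..<r})) \<le> card {x. poly p x = 0}"
        using p by (intro card_mono poly_roots_finite[OF \<open>p \<noteq> 0\<close>]) auto
      then show False using that p card_poly_roots_bound[OF \<open>p \<noteq> 0\<close>] by simp
    qed
    then show "coeff p n = 0" by simp
  qed
  have "1 \<notin> l ` {..<r}" if "ms_dmd_equiv_dft \<Gamma> \<psi> v n" "n = r"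
  proof
    assume "1 \<in> l ` {..<r}"
    \<comment> \<open>Monic of degree \<open>r = n\<close>, so its \<open>n\<close>-th coefficient
      is 1; it also vanishes at 1, which is one of the \<open>l k\<close>.\<close>
    define p where "p = (\<Prod>k<r. [:- l k, 1:])"
    have "degree p = n"
      unfolding p_def by (subst degree_prod_eq_sum_degree) (auto simp: that)
    moreover have "lead_coeff p = 1" by (simp add: p_def lead_coeff_prod)
    moreover have "poly p (l k) = 0" if "k < r" for k
      unfolding p_def poly_prod using that by (intro prod_zero) auto
    ultimately show False using \<open>1 \<in> l ` {..<r}\<close> that(1) unfolding dft_iff by force
  qed
  moreover have "card (insert 1 (l ` {..<r})) \<ge> r"
    using card by (metis card_insert_le finite_imageI finite_lessThan)
  ultimately show ?thesis
    using dft card by (auto simp: card_insert_if)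
qed

end
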